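(* Let $\mathcal C\subset\mathbb R^n$ and $\mathcal Q\subset\mathbb R^m$ be nonempty closed sets, and let $\Phi:\mathbb R^{l\times n}\times\mathbb R^{l\times m}\times\mathbb R^l\rightrightarrows\mathbb R^n\times\mathbb R^m$ be the solution map of the nonhomogeneous split equality problem, $$\Phi(A,B,c):=\{(x,y)\in\mathcal C\times\mathcal Q : Ax-By=c\}.$$ Let $(\bar A,\bar B,\bar c)\in\mathbb R^{l\times n}\times\mathbb R^{l\times m}\times\mathbb R^l$ and $(\bar x,\bar y)\in\Phi(\bar A,\bar B,\bar c)$. Suppose that $\mathcal C$ is normally regular at $\bar x$ and $\mathcal Q$ is normally regular at $\bar y$. Consider the regularity condition $$(\ast)\qquad \big(\bar A^{\rm T}\big)^{-1}\big(-N(\bar x;\mathcal C)\big)\cap\big(\bar B^{\rm T}\big)^{-1}\big(N(\bar y;\mathcal Q)\big)=\{0\}.$$ If $(\ast)$ is satisfied, then $\Phi$ is Lipschitz-like at $\big((\bar A,\bar B,\bar c),(\bar x,\bar y)\big)$. Conversely, if $\Phi$ is Lipschitz-like at $\big((\bar A,\bar B,\bar c),(\bar x,\bar y)\big)$, then $(\ast)$ holds, provided that $(\bar x,\bar y)\neq(0,0)$.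
   Context: All spaces are finite-dimensional Euclidean spaces (spaces of matrices carry the inner product $\langle A',A\rangle=\sum_{i,j}a'_{ij}a_{ij}$); products carry the sum norm. $M^{\rm T}$ is the transpose of a matrix $M$, and for a set $\Omega$, $M^{-1}(\Omega)=\{x: Mx\in\Omega\}$ denotes the preimage (so $(\bar A^{\rm T})^{-1}(\cdot)$ and $(\bar B^{\rm T})^{-1}(\cdot)$ are subsets of $\mathbb R^l$; no invertibility is assumed). Normal cones: for nonempty $\Omega\subset\mathbb R^p$ and $\bar x\in\Omega$, the regular (Fréchet) normal cone is $$\widehat N(\bar x;\Omega)=\Big\{x'\in\mathbb R^p : \limsup_{x\to\bar x,\,x\in\Omega}\frac{\langle x',x-\bar x\rangle}{\|x-\bar x\|}\le 0\Big\},$$ and the limiting (Mordukhovich) normal cone $N(\bar x;\Omega)$ is the set of all $x'\in\mathbb R^p$ for which there exist sequences $x_k\to\bar x$, $x'_k\to x'$ with $x'_k\in\widehat N(x_k;\Omega)$ for all $k$. Both are set to $\emptyset$ when the base point is not in $\Omega$. The set $\Omega$ is normally regular at $\bar x\in\Omega$ if $\widehat N(\bar x;\Omega)=N(\bar x;\Omega)$. Lipschitz-likeness (Aubin property): a set-valued map $F:X\rightrightarrows Y$ between finite-dimensional spaces is Lipschitz-like at $(\bar x,\bar y)$ with $\bar y\in F(\bar x)$ if there exist neighborhoods $U$ of $\bar x$, $V$ of $\bar y$ and a constant $\ell>0$ such that $F(x')\cap V\subset F(x)+\ell\|x'-x\|\,\overline{\mathbb B}_Y$ for all $x',x\in U$,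 where $\overline{\mathbb B}_Y$ is the closed unit ball of $Y$. *)

theory Defs
  imports "HOL-Analysis.Analysis"
begin

text \<open>
  The limsup is taken in the extended reals along \<open>at x within \<Omega>\<close>. At an isolated point of
  \<open>\<Omega>\<close> this filter is trivial and the limsup is \<open>-\<infinity>\<close>, so the cone is then the whole space.
\<close>

definition regular_normal_cone :: "'a::euclidean_space \<Rightarrow> 'a set \<Rightarrow> 'a set" where
  "regular_normal_cone x \<Omega> =
     {x'. x \<in> \<Omega> \<and>
          Limsup (at x within \<Omega>) (\<lambda>u. ereal ((x' \<bullet> (u - x)) / norm (u - x))) \<le> 0}"

definition limiting_normal_cone :: "'a::euclidean_space \<Rightarrow> 'a set \<Rightarrow> 'a set" where
  "limiting_normal_cone x \<Omega> =
     {x'. x \<in> \<Omega> \<and>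
          (\<exists>u u'. u \<longlonglongrightarrow> x \<and> u' \<longlonglongrightarrow> x' \<and>
                  (\<forall>k::nat. u' k \<in> regular_normal_cone (u k) \<Omega>))}"

definition normally_regular_at :: "'a::euclidean_space set \<Rightarrow> 'a \<Rightarrow> bool" where
  "normally_regular_at \<Omega> x \<longleftrightarrow>
     x \<in> \<Omega> \<and> regular_normal_cone x \<Omega> = limiting_normal_cone x \<Omega>"

text \<open>
  The library norm on a product type is the Euclidean one. Product spaces here carry the sum
  norm instead, so the norms of the two spaces are explicit parameters \<open>nX\<close>, \<open>nY\<close> of the
  Aubin property. The topology is the same for both norms.
\<close>

definition sum_norm :: "('a \<Rightarrow> real) \<Rightarrow> ('b \<Rightarrow> real) \<Rightarrow> 'a \<times> 'b \<Rightarrow> real" where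
  "sum_norm nX nY p = nX (fst p) + nY (snd p)"

definition lipschitz_like_at ::
  "('a::euclidean_space \<Rightarrow> real) \<Rightarrow> ('b::euclidean_space \<Rightarrow> real) \<Rightarrow>
   ('a \<Rightarrow> 'b set) \<Rightarrow> 'a \<Rightarrow> 'b \<Rightarrow> bool" where
  "lipschitz_like_at nX nY F x y \<longleftrightarrow>
     y \<in> F x \<and>
     (\<exists>U V l. open U \<and> x \<in> U \<and> open V \<and> y \<in> V \<and> l > 0 \<and>
        (\<forall>u'\<in>U. \<forall>u\<in>U.
           F u' \<inter> V \<subseteq> {v + (l * nX (u' - u)) *\<^sub>R b |v b. v \<in> F u \<and> nY b \<le> 1}))"

definition split_equality_solutions ::
  "(real^'n) set \<Rightarrow> (real^'m) set \<Rightarrow>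
   (real^'n^'l) \<times> (real^'m^'l) \<times> (real^'l) \<Rightarrow> ((real^'n) \<times> (real^'m)) set" where
  "split_equality_solutions C Q =
     (\<lambda>(A, B, c). {(x, y). x \<in> C \<and> y \<in> Q \<and> A *v x - B *v y = c})"

definition split_regularity_condition ::
  "(real^'n) set \<Rightarrow> (real^'m) set \<Rightarrow> real^'n^'l \<Rightarrow> real^'m^'l \<Rightarrow> real^'n \<Rightarrow> real^'m \<Rightarrow> bool" where
  "split_regularity_condition C Q A B x y \<longleftrightarrow>
     ((*v) (transpose A)) -` (uminus ` limiting_normal_cone x C) \<inter>
     ((*v) (transpose B)) -` (limiting_normal_cone y Q) = {0}"

end

theory Submission
  imports Defs
begin

text \<open>
  Write \<open>(\<ast>)\<close> for the regularity condition. By compactness of the unit sphere, it implies that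
  \<open>\<parallel>A\<^sup>T z + x\<^sup>*\<parallel> + \<parallel>y\<^sup>* - B\<^sup>T z\<parallel>\<close> is at least some \<open>\<gamma> > 0\<close> for all unit vectors \<open>z\<close> and all regular
  normals \<open>x\<^sup>*\<close>, \<open>y\<^sup>*\<close> at points near the reference point, and for all matrices near the
  reference matrices. Given a feasible point \<open>p\<^sub>0\<close> with residual \<open>r = \<parallel>Ax - By - c\<parallel> > 0\<close>, minimise
  the residual plus \<open>\<mu> \<parallel>p - p\<^sub>0\<parallel>\<^sup>2\<close>, where \<open>\<mu> = \<gamma>\<^sup>2 / (64 r)\<close>. The minimiser lies within
  \<open>8r/\<gamma>\<close> of \<open>p\<^sub>0\<close>, and by Fermat's rule a nonzero residual there would violate the
  uniform bound; so it is a solution. This error bound is the Aubin property.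

  Conversely, if \<open>z\<close> violates \<open>(\<ast>)\<close>, then by regularity \<open>-A\<^sup>T z\<close> and \<open>B\<^sup>T z\<close> are regular normals.
  Moving \<open>c\<close> to \<open>c - tz\<close> requires a displacement of the solution that increases
  one of these normals at first order in \<open>t\<close>, so it cannot be of size \<open>O(t)\<close>.
\<close>

section \<open>Regular normals: quotient-free form and Fermat's rule\<close>

text \<open>Multiplying out the quotient removes both the extended-real limsup and the punctured
  neighbourhood, so isolated points need no separate treatment later.\<close>

lemma regular_normal_cone_iff:
  "x' \<in> regular_normal_cone x \<Omega> \<longleftrightarrow> x \<in> \<Omega> \<and>
     (\<forall>e>0. \<exists>d>0. \<forall>u\<in>\<Omega>. norm (u - x) < d \<longrightarrow> x' \<bullet> (u - x) \<le> e * norm (u - x))"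
  (is "_ \<longleftrightarrow> _ \<and> ?R")
proof -
  let ?q = "\<lambda>u. (x' \<bullet> (u - x)) / norm (u - x)"
  have "Limsup (at x within \<Omega>) (\<lambda>u. ereal (?q u)) \<le> 0 \<longleftrightarrow>
      (\<forall>y>0. eventually (\<lambda>u. ereal (?q u) < y) (at x within \<Omega>))"
    by (rule Limsup_le_iff)
  also have "\<dots> \<longleftrightarrow> (\<forall>e>0. eventually (\<lambda>u. ?q u \<le> e) (at x within \<Omega>))"
  proof (intro iffI allI impI)
    fix e :: real
    assume "\<forall>y>0. eventually (\<lambda>u. ereal (?q u) < y) (at x within \<Omega>)" "0 < e"
    then have "eventually (\<lambda>u. ereal (?q u) < ereal e) (at x within \<Omega>)"
      by (metis ereal_less(2))
    then show "eventually (\<lambda>u. ?q u \<le> e) (at x within \<Omega>)"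
      by eventually_elim simp
  next
    fix y :: ereal
    assume *: "\<forall>e>0. eventually (\<lambda>u. ?q u \<le> e) (at x within \<Omega>)" and "0 < y"
    \<comment> \<open>The extended-real threshold \<open>y\<close> may be infinite; a real
      \<open>e\<close> strictly below it also turns the weak bound back into a strict one.\<close>
    then obtain e where "0 < ereal e" "ereal e < y"
      using ereal_dense2 by blast
    with * have "eventually (\<lambda>u. ?q u \<le> e) (at x within \<Omega>)"
      by simp
    then show "eventually (\<lambda>u. ereal (?q u) < y) (at x within \<Omega>)"
      by eventually_elim (use \<open>ereal e < y\<close> in \<open>meson ereal_less_eq(3) le_less_trans\<close>)
  qed
  also have "\<dots> \<longleftrightarrow> ?R"
  proof -
    have "eventually (\<lambda>u. ?q u \<le> e) (at x within \<Omega>) \<longleftrightarrow>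
        (\<exists>d>0. \<forall>u\<in>\<Omega>. norm (u - x) < d \<longrightarrow> x' \<bullet> (u - x) \<le> e * norm (u - x))" for e
    proof -
      \<comment> \<open>At \<open>u = x\<close> the multiplied-out inequality reads 0 \<le> 0, so
        the excluded base point can be readmitted.\<close>
      have "(u \<noteq> x \<and> dist u x < d \<longrightarrow> ?q u \<le> e) \<longleftrightarrow>
          (norm (u - x) < d \<longrightarrow> x' \<bullet> (u - x) \<le> e * norm (u - x))" for u d
        by (cases "u = x") (auto simp: dist_norm pos_divide_le_eq)
      then show ?thesis
        by (simp add: eventually_at)
    qed
    then show ?thesis
      by simp
  qed
  finally show ?thesis
    by (simp add: regular_normal_cone_def)
qed

lemma zero_in_limiting_normal_cone: "x \<in> \<Omega> \<Longrightarrow> 0 \<in> limiting_normal_cone x \<Omega>"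
proof -
  assume "x \<in> \<Omega>"
  then have "0 \<in> regular_normal_cone x \<Omega>"
    by (auto simp: regular_normal_cone_iff intro: exI[of _ 1])
  with \<open>x \<in> \<Omega>\<close> show ?thesis
    unfolding limiting_normal_cone_def
    by simp (rule exI[of _ "\<lambda>_. x"], rule conjI, simp, rule exI[of _ "\<lambda>_. 0"], simp)
qed

text \<open>At a minimiser over the set, \<open>g u - g x\<close> is nonnegative, so the first-order
  expansion leaves \<open>- d \<bullet> (u - x)\<close> bounded by the remainder, which is
  o(\<open>norm (u - x)\<close>).\<close>

lemma fermat_regular_normal:
  assumes "x \<in> \<Omega>" and min: "\<And>u. u \<in> \<Omega> \<Longrightarrow> g x \<le> g u"
    and der: "(g has_derivative (\<lambda>h. d \<bullet> h)) (at x)"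
  shows "- d \<in> regular_normal_cone x \<Omega>"
proof -
  have "\<exists>r>0. \<forall>u\<in>\<Omega>. norm (u - x) < r \<longrightarrow> - d \<bullet> (u - x) \<le> e * norm (u - x)" if e: "e > 0" for e
  proof -
    obtain r where "r > 0"
      and r: "\<forall>u\<in>UNIV. norm (u - x) < r \<longrightarrow> norm (g u - g x - d \<bullet> (u - x)) \<le> e * norm (u - x)"
      using der e unfolding has_derivative_within_alt by blast
    have "- d \<bullet> (u - x) \<le> e * norm (u - x)" if "u \<in> \<Omega>" "norm (u - x) < r" for u
      using r[rule_format, OF UNIV_I that(2)] min[OF that(1)] by simp
    with \<open>r > 0\<close> show ?thesis by blast
  qed
  with \<open>x \<in> \<Omega>\<close> show ?thesis
    by (simp add: regular_normal_cone_iff)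
qed

section \<open>Matrix estimates and the penalised residual\<close>

text \<open>Here \<open>norm A\<close> is the Frobenius norm, the one induced by the inner product
  on matrices; the bound is Cauchy-Schwarz applied row by row.\<close>

lemma norm_matrix_vector_mult_le:
  fixes A :: "real^'n^'l"
  shows "norm (A *v x) \<le> norm A * norm x"
proof -
  have "norm (A *v x) = L2_set (\<lambda>i. norm (A $ i \<bullet> x)) UNIV"
    by (simp add: norm_vec_def matrix_vector_mult_def inner_vec_def)
  also have "\<dots> \<le> L2_set (\<lambda>i. norm (A $ i) * norm x) UNIV"
    by (intro L2_set_mono) (auto simp: Cauchy_Schwarz_ineq2)
  also have "\<dots> = norm A * norm x"
    by (simp add: norm_vec_def[of A] L2_set_right_distrib L2_set_left_distrib[symmetric])
  finally show ?thesis .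
qed

lemma tendsto_vector_matrix_mult:
  fixes A :: "'b \<Rightarrow> real^'n^'l"
  assumes "(z \<longlongrightarrow> z0) F" "(A \<longlongrightarrow> A0) F"
  shows "((\<lambda>k. z k v* A k) \<longlongrightarrow> z0 v* A0) F"
  unfolding vector_matrix_mult_def
  by (intro tendsto_vec_lambda tendsto_sum tendsto_mult tendsto_vec_nth assms)

text \<open>A nonzero residual makes its norm differentiable, with gradient
  \<open>sgn (M *v w - b) v* M\<close>; the penalty contributes
  \<open>(2 * \<mu>) *\<^sub>R (w - w0)\<close>. The lemma serves one block of variables at a time,
  with the other block absorbed into \<open>b\<close>.\<close>

lemma penalised_residual_minimiser_normal:
  fixes M :: "real^'n^'l"
  assumes "w \<in> \<Omega>" "M *v w \<noteq> b"
    and "\<And>u. u \<in> \<Omega> \<Longrightarrow>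
      norm (M *v w - b) + \<mu> * (norm (w - w0))\<^sup>2 \<le> norm (M *v u - b) + \<mu> * (norm (u - w0))\<^sup>2"
  shows "- (sgn (M *v w - b) v* M + (2 * \<mu>) *\<^sub>R (w - w0)) \<in> regular_normal_cone w \<Omega>"
proof (rule fermat_regular_normal[where g = "\<lambda>u. norm (M *v u - b) + \<mu> * (norm (u - w0))\<^sup>2"])
  have 1: "((\<lambda>u. M *v u - b) has_derivative (\<lambda>h. M *v h)) (at w)"
    by (rule has_derivative_eq_rhs, rule derivative_intros)
       (auto intro!: derivative_intros bounded_linear_imp_has_derivative)
  have 2: "((\<lambda>u. norm (M *v u - b)) has_derivative (\<lambda>h. (M *v h) \<bullet> sgn (M *v w - b))) (at w)"
    using has_derivative_compose[OF 1 has_derivative_norm] assms(2) by simp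
  have 3: "((\<lambda>u. (u - w0) \<bullet> (u - w0)) has_derivative (\<lambda>h. 2 * ((w - w0) \<bullet> h))) (at w)"
    by (auto intro!: derivative_eq_intros simp: inner_commute)
  have 4: "(M *v h) \<bullet> s = (s v* M) \<bullet> h" for h s
    by (metis dot_lmul_matrix inner_commute)
  show "((\<lambda>u. norm (M *v u - b) + \<mu> * (norm (u - w0))\<^sup>2) has_derivative
      (\<lambda>h. (sgn (M *v w - b) v* M + (2 * \<mu>) *\<^sub>R (w - w0)) \<bullet> h)) (at w)"
    unfolding power2_norm_eq_inner
    by (rule has_derivative_eq_rhs, rule has_derivative_add[OF 2 has_derivative_mult_right[OF 3]])
       (auto simp: 4 inner_add_left)
qed (use assms in auto)

section \<open>Uniform nondegeneracy and the error bound\<close>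

text \<open>A failure for every \<gamma> produces sequences of regular normals whose limits are
  limiting normals at the reference point, paired with a unit vector, against the regularity
  condition. One \<gamma> serves both as radius and as lower bound.\<close>

lemma split_regularity_uniform:
  fixes A :: "real^'n^'l" and B :: "real^'m^'l"
  assumes reg: "split_regularity_condition C Q A B x y" and "x \<in> C" "y \<in> Q"
  obtains \<gamma> :: real where "\<gamma> > 0"
    and "\<And>A' B' x' y' xs ys z. dist A' A < \<gamma> \<Longrightarrow> dist B' B < \<gamma> \<Longrightarrow> dist x' x < \<gamma> \<Longrightarrow> dist y' y < \<gamma> \<Longrightarrow>
      xs \<in> regular_normal_cone x' C \<Longrightarrow> ys \<in> regular_normal_cone y' Q \<Longrightarrow> norm z = 1 \<Longrightarrow>
      \<gamma> \<le> norm (z v* A' + xs) + norm (ys - z v* B')"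
proof (rule ccontr)
  note * = that
  assume no: "\<not> thesis"
  let ?P = "\<lambda>\<gamma> A' B' x' y' xs ys z. dist A' A < \<gamma> \<and> dist B' B < \<gamma> \<and> dist x' x < \<gamma> \<and> dist y' y < \<gamma> \<and>
      xs \<in> regular_normal_cone x' C \<and> ys \<in> regular_normal_cone y' Q \<and> norm z = 1 \<and>
      norm (z v* A' + xs) + norm (ys - z v* B') < \<gamma>"
  have ex: "\<exists>A' B' x' y' xs ys z. ?P \<gamma> A' B' x' y' xs ys z" if "\<gamma> > 0" for \<gamma>
    using no *[OF that] by (meson not_le)
  have "\<forall>k. \<exists>A' B' x' y' xs ys z. ?P (inverse (real (Suc k))) A' B' x' y' xs ys z"
    by (intro allI ex) simp
  then obtain A' B' x' y' xs ys z where P: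
    "\<And>k. ?P (inverse (real (Suc k))) (A' k) (B' k) (x' k) (y' k) (xs k) (ys k) (z k)"
    by metis
  have "\<forall>k. z k \<in> sphere 0 1"
    using P by simp
  then obtain z0 s where z0: "z0 \<in> sphere 0 1" "strict_mono s" and zs: "(z \<circ> s) \<longlonglongrightarrow> z0"
    using compact_sphere[of "0 :: real^'l" 1] unfolding compact_def by metis
  have lim: "(\<lambda>k. inverse (real (Suc (s k)))) \<longlonglongrightarrow> 0"
    using LIMSEQ_subseq_LIMSEQ[OF LIMSEQ_inverse_real_of_nat z0(2)] by (simp add: o_def)
  have conv: "(\<lambda>k. v (s k)) \<longlonglongrightarrow> v0"
    if "\<And>k. dist (v k) v0 < inverse (real (Suc k))" for v :: "nat \<Rightarrow> 'c::metric_space" and v0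
    by (rule tendsto_dist_iff[THEN iffD2],
        rule Lim_null_comparison[OF _ lim], use that in \<open>auto intro!: always_eventually less_imp_le\<close>)
  have "(\<lambda>k. z (s k)) \<longlonglongrightarrow> z0" "(\<lambda>k. A' (s k)) \<longlonglongrightarrow> A" "(\<lambda>k. B' (s k)) \<longlonglongrightarrow> B"
    using zs P by (auto intro!: conv simp: o_def)
  then have lA: "(\<lambda>k. z (s k) v* A' (s k)) \<longlonglongrightarrow> z0 v* A" and lB: "(\<lambda>k. z (s k) v* B' (s k)) \<longlonglongrightarrow> z0 v* B"
    by (auto intro!: tendsto_vector_matrix_mult)
  \<comment> \<open>The normals are not assumed bounded: they converge because their sums with
    convergent sequences tend to 0.\<close>
  have "(\<lambda>k. z (s k) v* A' (s k) + xs (s k)) \<longlonglongrightarrow> 0"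
    by (rule conv) (use P in \<open>smt (verit) dist_norm norm_ge_zero diff_zero\<close>)
  from tendsto_diff[OF this lA] have "(\<lambda>k. xs (s k)) \<longlonglongrightarrow> - (z0 v* A)"
    by simp
  moreover have "(\<lambda>k. x' (s k)) \<longlonglongrightarrow> x"
    using P by (auto intro!: conv)
  ultimately have 1: "- (z0 v* A) \<in> limiting_normal_cone x C"
    unfolding limiting_normal_cone_def using P \<open>x \<in> C\<close> by blast
  have "(\<lambda>k. ys (s k) - z (s k) v* B' (s k)) \<longlonglongrightarrow> 0"
    by (rule conv) (use P in \<open>smt (verit) dist_norm norm_ge_zero diff_zero\<close>)
  from tendsto_add[OF this lB] have "(\<lambda>k. ys (s k)) \<longlonglongrightarrow> z0 v* B"
    by simp
  moreover have "(\<lambda>k. y' (s k)) \<longlonglongrightarrow> y"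
    using P by (auto intro!: conv)
  ultimately have 2: "z0 v* B \<in> limiting_normal_cone y Q"
    unfolding limiting_normal_cone_def using P \<open>y \<in> Q\<close> by blast
  \<comment> \<open>\<open>z0 v* A\<close> is \<open>transpose A *v z0\<close>, so this is
    membership in the first preimage.\<close>
  have "z0 v* A \<in> uminus ` limiting_normal_cone x C"
    using 1 by (metis imageI minus_minus)
  with 2 reg have "z0 = 0"
    unfolding split_regularity_condition_def by (auto simp: set_eq_iff)
  with z0(1) show False
    by simp
qed

text \<open>Nondegeneracy is demanded only in the box of radius \<open>8 * r / \<gamma>\<close>
  around the starting point, since the penalised minimiser cannot leave it.\<close>

lemma split_equality_error_bound:
  fixes A :: "real^'n^'l" and B :: "real^'m^'l" and x0 :: "real^'n" and y0 :: "real^'m"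
  assumes "closed C" "closed Q" "x0 \<in> C" "y0 \<in> Q" "\<gamma> > 0"
    and r_def: "r = norm (A *v x0 - B *v y0 - c)"
    and nondeg: "\<And>x y xs ys z. dist x x0 \<le> 8 * r / \<gamma> \<Longrightarrow> dist y y0 \<le> 8 * r / \<gamma> \<Longrightarrow>
      xs \<in> regular_normal_cone x C \<Longrightarrow> ys \<in> regular_normal_cone y Q \<Longrightarrow> norm z = 1 \<Longrightarrow>
      \<gamma> \<le> norm (z v* A + xs) + norm (ys - z v* B)"
  obtains x y where "(x, y) \<in> split_equality_solutions C Q (A, B, c)"
    "norm (x - x0) \<le> 8 * r / \<gamma>" "norm (y - y0) \<le> 8 * r / \<gamma>"
proof (cases "r = 0")
  case True
  with r_def \<open>x0 \<in> C\<close> \<open>y0 \<in> Q\<close> show ?thesis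
    by (intro that[of x0 y0]) (auto simp: split_equality_solutions_def)
next
  case False
  then have "r > 0"
    by (simp add: r_def)
  \<comment> \<open>This value makes \<open>\<mu> * (8 * r / \<gamma>)\<^sup>2 = r\<close>, which
    confines points of penalised value at most \<open>r\<close> to the box. There each of the two
    penalty gradients has norm at most \<gamma>/4, so together they stay below \<gamma>.\<close>
  define \<mu> where "\<mu> = \<gamma>\<^sup>2 / (64 * r)"
  have "\<mu> > 0"
    using \<open>r > 0\<close> \<open>\<gamma> > 0\<close> by (simp add: \<mu>_def)
  have \<mu>r: "\<mu> * (8 * r / \<gamma>)\<^sup>2 = r"
    using \<open>r > 0\<close> \<open>\<gamma> > 0\<close> by (simp add: \<mu>_def field_simps power2_eq_square)
  let ?g = "\<lambda>x y. norm (A *v x - B *v y - c) + \<mu> * ((norm (x - x0))\<^sup>2 + (norm (y - y0))\<^sup>2)"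
  have near: "norm (x - x0) \<le> 8 * r / \<gamma> \<and> norm (y - y0) \<le> 8 * r / \<gamma>" if "?g x y \<le> r" for x y
  proof -
    have "\<mu> * ((norm (x - x0))\<^sup>2 + (norm (y - y0))\<^sup>2) \<le> \<mu> * (8 * r / \<gamma>)\<^sup>2"
      unfolding \<mu>r using that norm_ge_zero[of "A *v x - B *v y - c"] by linarith
    then have *: "(norm (x - x0))\<^sup>2 + (norm (y - y0))\<^sup>2 \<le> (8 * r / \<gamma>)\<^sup>2"
      using \<open>\<mu> > 0\<close> by simp
    have "(norm (x - x0))\<^sup>2 \<le> (8 * r / \<gamma>)\<^sup>2" "(norm (y - y0))\<^sup>2 \<le> (8 * r / \<gamma>)\<^sup>2"
      using * zero_le_power2[of "norm (x - x0)"] zero_le_power2[of "norm (y - y0)"] by linarith+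
    then show ?thesis
      using \<open>r > 0\<close> \<open>\<gamma> > 0\<close> by (auto intro: power2_le_imp_le)
  qed
  let ?K = "(C \<inter> cball x0 (8 * r / \<gamma>)) \<times> (Q \<inter> cball y0 (8 * r / \<gamma>))"
  have "compact ?K"
    using assms by (intro compact_Times closed_Int_compact) auto
  moreover have "?K \<noteq> {}"
    using assms \<open>r > 0\<close> by auto
  moreover have "continuous_on ?K (\<lambda>p. ?g (fst p) (snd p))"
    by (intro continuous_intros continuous_on_compose2[OF matrix_vector_mult_linear_continuous_on[of UNIV]]) auto
  ultimately obtain p where "p \<in> ?K" and p: "\<And>q. q \<in> ?K \<Longrightarrow> ?g (fst p) (snd p) \<le> ?g (fst q) (snd q)"
    using continuous_attains_inf[of ?K "\<lambda>p. ?g (fst p) (snd p)"] by blast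
  obtain x y where pxy: "p = (x, y)"
    by fastforce
  have "x \<in> C" "y \<in> Q"
    using \<open>p \<in> ?K\<close> by (auto simp: pxy)
  have "?g x y \<le> ?g x0 y0"
    using p[of "(x0, y0)"] assms \<open>r > 0\<close> by (simp add: pxy)
  then have gr: "?g x y \<le> r"
    by (simp add: r_def)
  \<comment> \<open>The minimum over the compact box is global on \<open>C\<close> and
    \<open>Q\<close>: a competitor of value at most \<open>r\<close> lies in the box, and any other
    exceeds \<open>r\<close>, the value at the starting point.\<close>
  have min: "?g x y \<le> ?g u v" if "u \<in> C" "v \<in> Q" for u v
  proof (cases "?g u v \<le> r")
    case True
    then show ?thesis
      using p[of "(u, v)"] near[OF True] that by (simp add: pxy dist_norm norm_minus_commute)
  qed (use gr in linarith)
  note near_xy = near[OF gr]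
  have "A *v x - B *v y = c"
  proof (rule ccontr)
    assume neq: "A *v x - B *v y \<noteq> c"
    define z where "z = sgn (A *v x - B *v y - c)"
    have "norm z = 1"
      using neq by (simp add: z_def norm_sgn)
    \<comment> \<open>Freezing \<open>y\<close> makes \<open>x\<close> a minimiser over
      \<open>C\<close> alone, with target \<open>B *v y + c\<close>.\<close>
    have "- (sgn (A *v x - (B *v y + c)) v* A + (2 * \<mu>) *\<^sub>R (x - x0)) \<in> regular_normal_cone x C"
    proof (rule penalised_residual_minimiser_normal)
      fix u assume "u \<in> C"
      with min[of u y] \<open>y \<in> Q\<close>
      show "norm (A *v x - (B *v y + c)) + \<mu> * (norm (x - x0))\<^sup>2
          \<le> norm (A *v u - (B *v y + c)) + \<mu> * (norm (u - x0))\<^sup>2"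
        by (simp add: algebra_simps)
    qed (use neq \<open>x \<in> C\<close> in \<open>auto simp: algebra_simps\<close>)
    then have xs: "- (z v* A + (2 * \<mu>) *\<^sub>R (x - x0)) \<in> regular_normal_cone x C"
      by (simp add: z_def diff_diff_eq)
    have comm: "norm (B *v v - (A *v x - c)) = norm (A *v x - B *v v - c)" for v
      by (subst norm_minus_commute) (simp add: algebra_simps)
    \<comment> \<open>Freezing \<open>x\<close> instead reverses the sign of the residual, hence the
      opposite sign of \<open>z\<close> in the normal to \<open>Q\<close>.\<close>
    have "- (sgn (B *v y - (A *v x - c)) v* B + (2 * \<mu>) *\<^sub>R (y - y0)) \<in> regular_normal_cone y Q"
    proof (rule penalised_residual_minimiser_normal)
      fix v assume "v \<in> Q"
      with min[of x v] \<open>x \<in> C\<close>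
      show "norm (B *v y - (A *v x - c)) + \<mu> * (norm (y - y0))\<^sup>2
          \<le> norm (B *v v - (A *v x - c)) + \<mu> * (norm (v - y0))\<^sup>2"
        unfolding comm by (simp add: algebra_simps)
    qed (use neq \<open>y \<in> Q\<close> in \<open>auto simp: algebra_simps\<close>)
    moreover have "sgn (B *v y - (A *v x - c)) = - z"
      unfolding z_def by (subst sgn_minus[symmetric]) (simp add: algebra_simps)
    moreover have "(- z) v* B = - (z v* B)"
      by (simp add: vector_matrix_mult_def vec_eq_iff sum_negf)
    ultimately have ys: "z v* B - (2 * \<mu>) *\<^sub>R (y - y0) \<in> regular_normal_cone y Q"
      by simp
    \<comment> \<open>In both terms of \<open>nondeg\<close> the images of \<open>z\<close> cancel
      and only the penalty gradients survive.\<close>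
    have "\<gamma> \<le> norm ((2 * \<mu>) *\<^sub>R (x - x0)) + norm ((2 * \<mu>) *\<^sub>R (y - y0))"
      using nondeg[OF _ _ xs ys \<open>norm z = 1\<close>] near_xy
      by (simp add: dist_norm norm_minus_commute)
    also have "\<dots> = 2 * \<mu> * (norm (x - x0) + norm (y - y0))"
      using \<open>\<mu> > 0\<close> by (simp add: distrib_left)
    also have "\<dots> \<le> 2 * \<mu> * (8 * r / \<gamma> + 8 * r / \<gamma>)"
      using near_xy \<open>\<mu> > 0\<close> by (intro mult_left_mono add_mono) auto
    also have "\<dots> = \<gamma> / 2"
      using \<open>r > 0\<close> \<open>\<gamma> > 0\<close> by (simp add: \<mu>_def field_simps power2_eq_square)
    finally show False
      using \<open>\<gamma> > 0\<close> by simp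
  qed
  with \<open>x \<in> C\<close> \<open>y \<in> Q\<close> near_xy show ?thesis
    by (intro that) (auto simp: split_equality_solutions_def)
qed

section \<open>Sufficiency: from the error bound to the Aubin property\<close>

text \<open>Puts a distance estimate into the form used in \<open>lipschitz_like_at\<close>. The
  case \<open>K = 0\<close>, where division fails, arises when the two parameters coincide.\<close>

lemma sum_norm_scaled_unit:
  fixes p q :: "'a::euclidean_space \<times> 'b::euclidean_space"
  assumes "sum_norm norm norm (p - q) \<le> K"
  shows "\<exists>b. p = q + K *\<^sub>R b \<and> sum_norm norm norm b \<le> 1"
proof (cases "K = 0")
  case True
  with assms have "norm (fst (p - q)) + norm (snd (p - q)) \<le> 0"
    by (simp add: sum_norm_def)
  then have "fst (p - q) = 0 \<and> snd (p - q) = 0"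
    by (smt (verit) norm_ge_zero norm_eq_zero)
  then have "p = q"
    by (simp add: prod_eq_iff)
  then show ?thesis
    by (intro exI[of _ 0]) (simp add: sum_norm_def)
next
  case False
  have "0 \<le> sum_norm norm norm (p - q)"
    by (simp add: sum_norm_def)
  with False assms have "K > 0"
    by linarith
  have "sum_norm norm norm ((1 / K) *\<^sub>R (p - q)) = sum_norm norm norm (p - q) / K"
    using \<open>K > 0\<close> by (simp add: sum_norm_def add_divide_distrib divide_inverse_commute distrib_left)
  also have "\<dots> \<le> 1"
    using assms \<open>K > 0\<close> by simp
  finally show ?thesis
    using \<open>K > 0\<close> by (intro exI[of _ "(1 / K) *\<^sub>R (p - q)"]) simp
qed

lemma split_regularity_imp_lipschitz_like:
  fixes A :: "real^'n^'l" and B :: "real^'m^'l"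
  assumes "closed C" "closed Q" and sol: "(x, y) \<in> split_equality_solutions C Q (A, B, c)"
    and reg: "split_regularity_condition C Q A B x y"
  shows "lipschitz_like_at (sum_norm norm (sum_norm norm norm)) (sum_norm norm norm)
    (split_equality_solutions C Q) (A, B, c) (x, y)"
proof -
  have "x \<in> C" "y \<in> Q"
    using sol by (auto simp: split_equality_solutions_def)
  obtain \<gamma> :: real where "\<gamma> > 0" and \<gamma>:
    "\<And>A' B' x' y' xs ys z. dist A' A < \<gamma> \<Longrightarrow> dist B' B < \<gamma> \<Longrightarrow> dist x' x < \<gamma> \<Longrightarrow> dist y' y < \<gamma> \<Longrightarrow>
      xs \<in> regular_normal_cone x' C \<Longrightarrow> ys \<in> regular_normal_cone y' Q \<Longrightarrow> norm z = 1 \<Longrightarrow>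
      \<gamma> \<le> norm (z v* A' + xs) + norm (ys - z v* B')"
    using split_regularity_uniform[OF reg \<open>x \<in> C\<close> \<open>y \<in> Q\<close>] by blast
  \<comment> \<open>\<open>K\<close> bounds the norms of both components of points near the
    reference solution; the summand 1 lets it also absorb the coefficient 1 of the change in
    \<open>c\<close>.\<close>
  define K where "K = norm x + norm y + \<gamma> + 1"
  have "K \<ge> 1"
    using \<open>\<gamma> > 0\<close> by (simp add: K_def)
  \<comment> \<open>Two parameters in the neighbourhood differ by at most \<open>6 * \<eta>\<close>,
    so residuals are at most \<open>6 * K * \<eta>\<close>. The value \<gamma>^2/(96K) then makes
    the box radius at most \<gamma>/2, which together with the \<gamma>/2 in \<open>?V\<close> stays
    inside the radius \<gamma>.\<close>
  define \<eta> where "\<eta> = min \<gamma> (\<gamma>\<^sup>2 / (96 * K))"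
  have "\<eta> > 0" "\<eta> \<le> \<gamma>"
    using \<open>\<gamma> > 0\<close> \<open>K \<ge> 1\<close> by (auto simp: \<eta>_def)
  have "\<eta> \<le> \<gamma>\<^sup>2 / (96 * K)"
    by (simp add: \<eta>_def)
  then have \<eta>K: "8 * (K * (6 * \<eta>)) / \<gamma> \<le> \<gamma> / 2"
    using \<open>\<gamma> > 0\<close> \<open>K \<ge> 1\<close> by (simp add: field_simps power2_eq_square)
  let ?U = "ball A \<eta> \<times> ball B \<eta> \<times> ball c \<eta>"
  let ?V = "ball x (\<gamma> / 2) \<times> ball y (\<gamma> / 2)"
  let ?N = "sum_norm norm (sum_norm norm norm) :: (real^'n^'l) \<times> (real^'m^'l) \<times> (real^'l) \<Rightarrow> real"
  \<comment> \<open>Two components, each displaced by at most \<open>8 * r / \<gamma>\<close>, with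
    \<open>r\<close> at most \<open>K\<close> times the parameter distance.\<close>
  let ?l = "16 * K / \<gamma>"
  have incl: "split_equality_solutions C Q u' \<inter> ?V \<subseteq>
      {v + (?l * ?N (u' - u)) *\<^sub>R b |v b. v \<in> split_equality_solutions C Q u \<and> sum_norm norm norm b \<le> 1}"
    if "u' \<in> ?U" "u \<in> ?U" for u' u
  proof
    fix p assume p: "p \<in> split_equality_solutions C Q u' \<inter> ?V"
    obtain A1 B1 c1 A2 B2 c2 x0 y0 where eqs: "u' = (A1, B1, c1)" "u = (A2, B2, c2)" "p = (x0, y0)"
      by (metis prod.collapse)
    have in_CQ: "x0 \<in> C" "y0 \<in> Q" and c1: "A1 *v x0 - B1 *v y0 = c1"
      using p by (auto simp: split_equality_solutions_def eqs)
    have dist0: "dist x0 x < \<gamma> / 2" "dist y0 y < \<gamma> / 2"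
      using p by (auto simp: eqs dist_commute)
    have dU: "dist A1 A < \<eta>" "dist B1 B < \<eta>" "dist c1 c < \<eta>" "dist A2 A < \<eta>" "dist B2 B < \<eta>" "dist c2 c < \<eta>"
      using that by (auto simp: eqs dist_commute)
    have N: "?N (u' - u) = dist A1 A2 + dist B1 B2 + dist c1 c2"
      by (simp add: sum_norm_def eqs dist_norm)
    have N_le: "?N (u' - u) \<le> 6 * \<eta>"
      unfolding N using dU dist_triangle2[of A1 A2 A] dist_triangle2[of B1 B2 B] dist_triangle2[of c1 c2 c]
      by linarith
    define r where "r = norm (A2 *v x0 - B2 *v y0 - c2)"
    \<comment> \<open>Subtracting the equation solved by \<open>(x0, y0)\<close> for the first
      parameter leaves a residual made only of data differences.\<close>
    have "r = norm ((A1 - A2) *v x0 - (B1 - B2) *v y0 - (c1 - c2))"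
      unfolding r_def c1[symmetric]
      by (subst norm_minus_commute) (simp add: matrix_vector_mult_diff_rdistrib algebra_simps)
    also have "\<dots> \<le> norm ((A1 - A2) *v x0) + norm ((B1 - B2) *v y0) + norm (c1 - c2)"
      by (meson add_mono norm_triangle_ineq4 order_refl order_trans)
    also have "\<dots> \<le> norm (A1 - A2) * K + norm (B1 - B2) * K + norm (c1 - c2) * K"
    proof (intro add_mono)
      have "norm x0 \<le> norm x + dist x0 x" "norm y0 \<le> norm y + dist y0 y"
        by (metis dist_norm norm_triangle_sub)+
      with dist0 \<open>\<gamma> > 0\<close> have "norm x0 \<le> K" "norm y0 \<le> K"
        using norm_ge_zero[of x] norm_ge_zero[of y] unfolding K_def by linarith+
      then show "norm ((A1 - A2) *v x0) \<le> norm (A1 - A2) * K"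
        and "norm ((B1 - B2) *v y0) \<le> norm (B1 - B2) * K"
        by (meson norm_matrix_vector_mult_le mult_left_mono norm_ge_zero order_trans)+
      show "norm (c1 - c2) \<le> norm (c1 - c2) * K"
        using \<open>K \<ge> 1\<close> by (simp add: mult_le_cancel_left1)
    qed
    also have "\<dots> = K * ?N (u' - u)"
      by (simp add: N dist_norm algebra_simps)
    finally have r_le: "r \<le> K * ?N (u' - u)" .
    then have r_bound: "8 * r / \<gamma> \<le> 8 * (K * ?N (u' - u)) / \<gamma>"
      using \<open>\<gamma> > 0\<close> by (simp add: divide_right_mono)
    also have "\<dots> \<le> 8 * (K * (6 * \<eta>)) / \<gamma>"
      using \<open>\<gamma> > 0\<close> \<open>K \<ge> 1\<close> N_le by (intro divide_right_mono mult_left_mono) auto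
    finally have r_small: "8 * r / \<gamma> \<le> \<gamma> / 2"
      using \<eta>K by linarith
    obtain x1 y1 where sol1: "(x1, y1) \<in> split_equality_solutions C Q u"
      and "norm (x1 - x0) \<le> 8 * r / \<gamma>" "norm (y1 - y0) \<le> 8 * r / \<gamma>"
    proof (rule split_equality_error_bound[OF \<open>closed C\<close> \<open>closed Q\<close> in_CQ \<open>\<gamma> > 0\<close> r_def])
      fix x' y' xs ys and z :: "real^'l"
      assume *: "dist x' x0 \<le> 8 * r / \<gamma>" "dist y' y0 \<le> 8 * r / \<gamma>"
        and n: "xs \<in> regular_normal_cone x' C" "ys \<in> regular_normal_cone y' Q" "norm z = 1"
      have "dist x' x < \<gamma>" "dist y' y < \<gamma>"
        using * r_small dist0 dist_triangle[of x' x x0] dist_triangle[of y' y y0] by linarith+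
      with \<gamma>[OF _ _ _ _ n] dU \<open>\<eta> \<le> \<gamma>\<close> show "\<gamma> \<le> norm (z v* A2 + xs) + norm (ys - z v* B2)"
        by auto
    qed (use eqs in auto)
    then have "sum_norm norm norm (p - (x1, y1)) \<le> 2 * (8 * r / \<gamma>)"
      by (simp add: sum_norm_def eqs norm_minus_commute)
    also have "\<dots> \<le> ?l * ?N (u' - u)"
      using r_bound by simp
    finally have "sum_norm norm norm (p - (x1, y1)) \<le> ?l * ?N (u' - u)" .
    from sum_norm_scaled_unit[OF this] sol1
    show "p \<in> {v + (?l * ?N (u' - u)) *\<^sub>R b |v b. v \<in> split_equality_solutions C Q u \<and> sum_norm norm norm b \<le> 1}"
      by blast
  qed
  show ?thesis
    unfolding lipschitz_like_at_def
  proof (intro conjI exI[of _ ?U] exI[of _ ?V] exI[of _ ?l] ballI incl)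
    show "open ?U" "open ?V"
      by (auto intro!: open_Times)
    show "?l > 0"
      using \<open>\<gamma> > 0\<close> \<open>K \<ge> 1\<close> by simp
  qed (use sol \<open>\<eta> > 0\<close> \<open>\<gamma> > 0\<close> in auto)
qed

section \<open>Necessity of the regularity condition\<close>

text \<open>Normal regularity replaces limiting normals by regular ones, whose defining inequality
  holds at the reference point itself; perturbing \<open>c\<close> alone then suffices.\<close>

lemma lipschitz_like_imp_split_regularity:
  fixes A :: "real^'n^'l" and B :: "real^'m^'l"
  assumes "normally_regular_at C x" "normally_regular_at Q y"
    and lip: "lipschitz_like_at (sum_norm norm (sum_norm norm norm)) (sum_norm norm norm)
      (split_equality_solutions C Q) (A, B, c) (x, y)"
  shows "split_regularity_condition C Q A B x y"
proof -
  let ?N = "sum_norm norm (sum_norm norm norm) :: (real^'n^'l) \<times> (real^'m^'l) \<times> (real^'l) \<Rightarrow> real"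
  have "x \<in> C" "y \<in> Q" and limC: "limiting_normal_cone x C = regular_normal_cone x C"
    and limQ: "limiting_normal_cone y Q = regular_normal_cone y Q"
    using assms by (auto simp: normally_regular_at_def)
  obtain U V l where "open U" "(A, B, c) \<in> U" "(x, y) \<in> V" "l > 0"
    and l: "\<forall>u'\<in>U. \<forall>u\<in>U. split_equality_solutions C Q u' \<inter> V \<subseteq>
      {v + (l * ?N (u' - u)) *\<^sub>R b |v b. v \<in> split_equality_solutions C Q u \<and> sum_norm norm norm b \<le> 1}"
    using lip unfolding lipschitz_like_at_def by (elim conjE exE) (rule that; assumption)
  have sol: "(x, y) \<in> split_equality_solutions C Q (A, B, c)"
    using lip by (simp add: lipschitz_like_at_def)
  have "z = 0" if zA: "- (z v* A) \<in> regular_normal_cone x C" and zB: "z v* B \<in> regular_normal_cone y Q" for z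
  proof (rule ccontr)
    assume "z \<noteq> 0"
    \<comment> \<open>Chosen so that a displacement of at most \<open>l * (t * norm z)\<close> gains
      at most half of the required \<open>t * (norm z)\<^sup>2\<close>.\<close>
    define e where "e = norm z / (2 * l)"
    have "e > 0"
      using \<open>z \<noteq> 0\<close> \<open>l > 0\<close> by (simp add: e_def)
    obtain d1 where "d1 > 0" and d1:
      "\<And>u. u \<in> C \<Longrightarrow> norm (u - x) < d1 \<Longrightarrow> - (z v* A) \<bullet> (u - x) \<le> e * norm (u - x)"
      using zA \<open>e > 0\<close> unfolding regular_normal_cone_iff by blast
    obtain d2 where "d2 > 0" and d2:
      "\<And>u. u \<in> Q \<Longrightarrow> norm (u - y) < d2 \<Longrightarrow> (z v* B) \<bullet> (u - y) \<le> e * norm (u - y)"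
      using zB \<open>e > 0\<close> unfolding regular_normal_cone_iff by blast
    have "((\<lambda>t. (A, B, c - t *\<^sub>R z)) \<longlongrightarrow> (A, B, c - 0 *\<^sub>R z)) (at_right 0)"
      by (intro tendsto_intros)
    then have "\<forall>\<^sub>F t in at_right 0. (A, B, c - t *\<^sub>R z) \<in> U"
      using topological_tendstoD \<open>open U\<close> \<open>(A, B, c) \<in> U\<close> by fastforce
    \<comment> \<open>Small \<open>t\<close> keeps the displaced solution within the radii where
      both normal inequalities hold.\<close>
    moreover have "((\<lambda>t. l * (t * norm z)) \<longlongrightarrow> l * (0 * norm z)) (at_right 0)"
      by (intro tendsto_intros)
    from order_tendstoD(2)[OF this, of "min d1 d2"]
    have "\<forall>\<^sub>F t in at_right 0. l * (t * norm z) < min d1 d2"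
      using \<open>d1 > 0\<close> \<open>d2 > 0\<close> by simp
    moreover have "\<forall>\<^sub>F t in at_right 0. (0::real) < t"
      by (simp add: eventually_at_right_less)
    ultimately have "\<forall>\<^sub>F t in at_right 0.
        (A, B, c - t *\<^sub>R z) \<in> U \<and> l * (t * norm z) < min d1 d2 \<and> 0 < t"
      by eventually_elim simp
    then obtain t where t: "(A, B, c - t *\<^sub>R z) \<in> U" "l * (t * norm z) < min d1 d2" "0 < t"
      using eventually_happens[of _ "at_right (0::real)"] trivial_limit_at_right_real by blast
    have N: "?N ((A, B, c) - (A, B, c - t *\<^sub>R z)) = t * norm z"
      using \<open>0 < t\<close> by (simp add: sum_norm_def)
    \<comment> \<open>The inclusion is used from the reference parameter to the shifted one: it
      supplies a solution of the shifted problem close to \<open>(x, y)\<close>.\<close>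
    obtain x1 y1 b where v: "(x1, y1) \<in> split_equality_solutions C Q (A, B, c - t *\<^sub>R z)"
      and eq: "(x, y) = (x1, y1) + (l * (t * norm z)) *\<^sub>R b" and b: "sum_norm norm norm b \<le> 1"
      using l[THEN bspec, OF \<open>(A, B, c) \<in> U\<close>, THEN bspec, OF t(1)] sol \<open>(x, y) \<in> V\<close> unfolding N by fast
    have xe: "x1 - x = - (l * (t * norm z)) *\<^sub>R fst b" and ye: "y1 - y = - (l * (t * norm z)) *\<^sub>R snd b"
      using eq by (auto simp: prod_eq_iff)
    have "norm (x1 - x) + norm (y1 - y) = l * (t * norm z) * sum_norm norm norm b"
      unfolding xe ye using \<open>l > 0\<close> \<open>0 < t\<close> by (simp add: sum_norm_def abs_mult algebra_simps)
    also have "\<dots> \<le> l * (t * norm z)"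
      using b \<open>l > 0\<close> \<open>0 < t\<close> by (intro mult_left_le) auto
    finally have disp: "norm (x1 - x) + norm (y1 - y) \<le> l * (t * norm z)" .
    then have small: "norm (x1 - x) < d1" "norm (y1 - y) < d2"
      using t(2) norm_ge_zero[of "x1 - x"] norm_ge_zero[of "y1 - y"] by linarith+
    have "x1 \<in> C" "y1 \<in> Q" and c1: "A *v x1 - B *v y1 = c - t *\<^sub>R z" and c0: "A *v x - B *v y = c"
      using v sol by (auto simp: split_equality_solutions_def)
    have "t *\<^sub>R z = B *v (y1 - y) - A *v (x1 - x)"
      using c1 c0 by (simp add: matrix_vector_mult_diff_distrib algebra_simps)
    \<comment> \<open>Pairing the equation for the displacement with \<open>z\<close> moves the
      matrices onto \<open>z\<close>, where they become the two normals.\<close>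
    then have "z \<bullet> (t *\<^sub>R z) = (z v* B) \<bullet> (y1 - y) + (- (z v* A)) \<bullet> (x1 - x)"
      by (simp add: inner_diff_right dot_lmul_matrix matrix_vector_mult_diff_distrib)
    also have "\<dots> \<le> e * (norm (x1 - x) + norm (y1 - y))"
      using d1[OF \<open>x1 \<in> C\<close> small(1)] d2[OF \<open>y1 \<in> Q\<close> small(2)] by (simp add: distrib_left)
    also have "\<dots> \<le> e * (l * (t * norm z))"
      using disp \<open>e > 0\<close> by simp
    also have "\<dots> = t * (norm z)\<^sup>2 / 2"
      using \<open>l > 0\<close> by (simp add: e_def power2_eq_square)
    finally have "t * (norm z)\<^sup>2 \<le> t * (norm z)\<^sup>2 / 2"
      by (simp add: power2_norm_eq_inner)
    moreover have "t * (norm z)\<^sup>2 > 0"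
      using \<open>0 < t\<close> \<open>z \<noteq> 0\<close> by simp
    ultimately show False
      by linarith
  qed
  \<comment> \<open>The condition is an equality of sets, so 0 must also be shown to belong to the
    intersection.\<close>
  moreover have "0 \<in> regular_normal_cone x C" "0 \<in> regular_normal_cone y Q"
    using zero_in_limiting_normal_cone \<open>x \<in> C\<close> \<open>y \<in> Q\<close> limC limQ by blast+
  ultimately show ?thesis
    unfolding split_regularity_condition_def limC limQ by (auto simp: image_iff)
qed

theorem theorem3p1:
  fixes C :: "(real^'n) set" and Q :: "(real^'m) set"
    and A :: "real^'n^'l" and B :: "real^'m^'l" and c :: "real^'l"
    and x :: "real^'n" and y :: "real^'m"
  assumes "closed C" and "C \<noteq> {}" and "closed Q" and "Q \<noteq> {}"
    and "(x, y) \<in> split_equality_solutions C Q (A, B, c)"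
    and "normally_regular_at C x" and "normally_regular_at Q y"
  shows "(split_regularity_condition C Q A B x y \<longrightarrow>
            lipschitz_like_at (sum_norm norm (sum_norm norm norm)) (sum_norm norm norm)
              (split_equality_solutions C Q) (A, B, c) (x, y)) \<and>
         ((x, y) \<noteq> (0, 0) \<longrightarrow>
            lipschitz_like_at (sum_norm norm (sum_norm norm norm)) (sum_norm norm norm)
              (split_equality_solutions C Q) (A, B, c) (x, y) \<longrightarrow>
            split_regularity_condition C Q A B x y)"
  using split_regularity_imp_lipschitz_like[OF assms(1,3,5)]
    lipschitz_like_imp_split_regularity[OF assms(6,7)] by blast

end
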